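(* Let $\alpha>0$, $L>0$, and let $f:\mathbb{R}^d\to\mathbb{R}$ be $\alpha$-strongly convex and $L$-smooth, with minimizer $x^*$. Let the step size $s>0$ satisfy $s\le \frac{1}{\sqrt{L}}$. Given $x_0,v_0\in\mathbb{R}^d$, let $(x_n,v_n)_{n\ge 0}$ be generated by $$\begin{aligned} x_n' &= x_n + s v_n,\\ v_n' &= v_n - (1+s\sqrt{\alpha})^{-1}\left(s\sqrt{\alpha}\,v_n + s\nabla f(x_n')\right) - s\sqrt{\alpha}\,v_n',\\ x_{n+1} &= x_n' - \tfrac{1}{L}\nabla f(x_n'),\\ v_{n+1} &= v_n' + (1+s\sqrt{\alpha})^{-1}\tfrac{\sqrt{\alpha}}{L}\nabla f(x_n'), \end{aligned}$$ and set $$L_n = f(x_n)-f(x^* )+\tfrac12\left\|\sqrt{\alpha}(x_n-x^* )+(1+s\sqrt{\alpha})v_n\right\|^2 .$$ Then for all $n\ge 0$, $$L_{n+1}\le (1+s\sqrt{\alpha})^{-1}L_n .$$ In particular, if $v_0=0$, then for all $n\ge 0$, $$f(x_n)-f(x^* )\le 2\left(1+s\sqrt{\alpha}\right)^{-n}\left(f(x_0)-f(x^* )\right).$$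
   Context: Here $\|\cdot\|$ is the Euclidean norm on $\mathbb{R}^d$ and $\langle\cdot,\cdot\rangle$ the Euclidean inner product. A convex function $f$ is $\alpha$-strongly convex if for all $x,y$ and every subgradient $g\in\partial f(y)$, $f(x)\ge f(y)+\langle g,x-y\rangle+\frac{\alpha}{2}\|x-y\|^2$. A differentiable function $f$ is $L$-smooth if $\|\nabla f(x)-\nabla f(y)\|\le L\|x-y\|$ for all $x,y$. The second line of the iteration is an implicit (linear) equation which uniquely determines $v_n'$, since $1+s\sqrt\alpha>0$. The symbol $L$ without index is the smoothness constant; $L_n$ with index is the Lyapunov quantity. *)

theory Defs
  imports "HOL-Analysis.Analysis"
begin

definition subdifferential :: "('a::real_inner \<Rightarrow> real) \<Rightarrow> 'a \<Rightarrow> 'a set" where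
  "subdifferential f y = {g. \<forall>x. f x \<ge> f y + g \<bullet> (x - y)}"

definition strongly_convex :: "real \<Rightarrow> ('a::real_inner \<Rightarrow> real) \<Rightarrow> bool" where
  "strongly_convex \<alpha> f \<longleftrightarrow> convex_on UNIV f \<and>
     (\<forall>x y. \<forall>g \<in> subdifferential f y. f x \<ge> f y + g \<bullet> (x - y) + \<alpha> / 2 * (norm (x - y))\<^sup>2)"

(* Unspecified where f is not differentiable; see GDERIV_gradient below. *)
definition gradient :: "('a::real_inner \<Rightarrow> real) \<Rightarrow> 'a \<Rightarrow> 'a" where
  "gradient f x = (THE g. GDERIV f x :> g)"

definition L_smooth :: "real \<Rightarrow> ('a::real_inner \<Rightarrow> real) \<Rightarrow> bool" where
  "L_smooth L f \<longleftrightarrow> (\<forall>x. f differentiable (at x)) \<and>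
     (\<forall>x y. norm (gradient f x - gradient f y) \<le> L * norm (x - y))"

lemma GDERIV_gradient:
  fixes f :: "'a::euclidean_space \<Rightarrow> real"
  assumes "f differentiable (at x)"
  shows "GDERIV f x :> gradient f x"
proof -
  obtain D where D: "(f has_derivative D) (at x)"
    using assms by (auto simp: differentiable_def)
  then have lin: "linear D"
    by (rule has_derivative_linear)
  define g where "g = (\<Sum>b\<in>Basis. D b *\<^sub>R b)"
  have "D h = h \<bullet> g" for h
  proof -
    have "D h = D (\<Sum>b\<in>Basis. (h \<bullet> b) *\<^sub>R b)"
      by (simp add: euclidean_representation)
    also have "\<dots> = (\<Sum>b\<in>Basis. (h \<bullet> b) * D b)"
      by (simp add: linear_sum[OF lin] linear_cmul[OF lin])
    also have "\<dots> = h \<bullet> g"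
      by (simp add: g_def inner_sum_right mult.commute)
    finally show ?thesis .
  qed
  then have "D = (\<lambda>h. h \<bullet> g)" by blast
  with D have g: "GDERIV f x :> g"
    by (simp add: gderiv_def)
  have "g' = g" if "GDERIV f x :> g'" for g'
  proof -
    have "(\<lambda>h. h \<bullet> g') = (\<lambda>h. h \<bullet> g)"
      using that g unfolding gderiv_def by (rule has_derivative_unique)
    then show ?thesis
      by (metis inner_commute vector_eq_rdot)
  qed
  with g show ?thesis
    unfolding gradient_def by (rule theI)
qed

end

theory Submission
  imports Defs
begin

text \<open>
  Write \<open>t = s * sqrt \<alpha>\<close>, \<open>c = 1 + t\<close>, \<open>g = \<nabla>f(x'\<^sub>n)\<close> and \<open>p = x'\<^sub>n - x*\<close>. Solving the implicit equation
  gives \<open>v'\<^sub>n = (v\<^sub>n - s g) / c\<^sup>2\<close>, and the vector in the Lyapunov quantity becomes \<open>sqrt \<alpha> p + v\<^sub>n\<close>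
  at time \<open>n\<close> and \<open>sqrt \<alpha> p + (v\<^sub>n - s g) / c\<close> at time \<open>n + 1\<close>. Using the descent lemma for \<open>f(x\<^sub>n\<^sub>+\<^sub>1)\<close>
  and strong convexity at \<open>x'\<^sub>n\<close> (towards \<open>x*\<close> and \<open>x\<^sub>n\<close>), all terms involving \<open>p\<close> cancel in
  \<open>c L\<^sub>n\<^sub>+\<^sub>1 - L\<^sub>n\<close>, and what remains is a quadratic form in \<open>v\<^sub>n\<close> and \<open>g\<close>, nonpositive since \<open>s\<^sup>2 \<le> 1/L\<close>.
\<close>

lemma GDERIV_along_line:
  assumes "GDERIV f (y + t *\<^sub>R h) :> g"
  shows "((\<lambda>t. f (y + t *\<^sub>R h)) has_real_derivative h \<bullet> g) (at t)"
proof -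
  have "((\<lambda>t. y + t *\<^sub>R h) has_derivative (\<lambda>u. u *\<^sub>R h)) (at t)"
    by (auto intro!: derivative_eq_intros)
  moreover have "(f has_derivative (\<lambda>k. k \<bullet> g)) (at (y + t *\<^sub>R h))"
    using assms by (simp add: gderiv_def)
  ultimately have "((\<lambda>t. f (y + t *\<^sub>R h)) has_derivative (\<lambda>u. (u *\<^sub>R h) \<bullet> g)) (at t)"
    by (rule has_derivative_compose)
  moreover have "(\<lambda>u. (u *\<^sub>R h) \<bullet> g) = (*) (h \<bullet> g)"
    by (auto simp: mult.commute)
  ultimately show ?thesis
    by (simp add: has_field_derivative_def)
qed

text \<open>Along the line from \<open>y\<close> to \<open>x\<close>, convexity reduces to a real
  convex function lying above its tangent. This makes strong convexity, which is stated for
  subgradients, usable with \<open>gradient f y\<close>.\<close>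

lemma GDERIV_in_subdifferential:
  assumes "convex_on UNIV f" and "GDERIV f y :> g"
  shows "g \<in> subdifferential f y"
proof -
  have "f x \<ge> f y + g \<bullet> (x - y)" for x
  proof -
    define \<phi> where "\<phi> t = f (y + t *\<^sub>R (x - y))" for t :: real
    have "convex_on UNIV \<phi>"
    proof (rule convex_onI)
      fix u a b :: real
      assume u: "0 < u" "u < 1"
      have "y + ((1 - u) *\<^sub>R a + u *\<^sub>R b) *\<^sub>R (x - y)
          = (1 - u) *\<^sub>R (y + a *\<^sub>R (x - y)) + u *\<^sub>R (y + b *\<^sub>R (x - y))"
        by (simp add: algebra_simps)
      then show "\<phi> ((1 - u) *\<^sub>R a + u *\<^sub>R b) \<le> (1 - u) * \<phi> a + u * \<phi> b"
        using convex_onD[OF assms(1), of u] u by (simp add: \<phi>_def)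
    qed simp
    moreover have "(\<phi> has_real_derivative (x - y) \<bullet> g) (at 0 within UNIV)"
      unfolding \<phi>_def using assms(2) by (intro GDERIV_along_line) simp
    ultimately have "\<phi> 1 - \<phi> 0 \<ge> ((x - y) \<bullet> g) * (1 - 0)"
      by (intro convex_on_imp_above_tangent[where A = UNIV]) auto
    then show ?thesis
      by (simp add: \<phi>_def inner_commute)
  qed
  then show ?thesis
    by (simp add: subdifferential_def)
qed

lemma strongly_convex_gradient_lower_bound:
  fixes f :: "'a::euclidean_space \<Rightarrow> real"
  assumes "strongly_convex \<alpha> f" and "f differentiable (at y)"
  shows "f x \<ge> f y + gradient f y \<bullet> (x - y) + \<alpha> / 2 * (norm (x - y))\<^sup>2"
proof -
  have "gradient f y \<in> subdifferential f y"
    using assms by (intro GDERIV_in_subdifferential GDERIV_gradient) (auto simp: strongly_convex_def)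
  then show ?thesis
    using assms(1) by (auto simp: strongly_convex_def)
qed

text \<open>Global minimality says exactly that 0 is a subgradient at \<open>z\<close>, which kills
  the linear term.\<close>

lemma strongly_convex_minimizer_lower_bound:
  assumes "strongly_convex \<alpha> f" and "\<forall>y. f z \<le> f y"
  shows "f x \<ge> f z + \<alpha> / 2 * (norm (x - z))\<^sup>2"
proof -
  have "0 \<in> subdifferential f z"
    using assms(2) by (simp add: subdifferential_def)
  then show ?thesis
    using assms(1) by (force simp: strongly_convex_def)
qed

text \<open>The descent lemma. On the segment from \<open>y\<close> to \<open>y + h\<close>, the
  difference between \<open>f\<close> and its quadratic model has nonpositive derivative, by
  Cauchy-Schwarz and the Lipschitz bound on the gradient.\<close>

lemma L_smooth_upper_bound:
  fixes f :: "'a::euclidean_space \<Rightarrow> real"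
  assumes "L_smooth L f"
  shows "f (y + h) \<le> f y + gradient f y \<bullet> h + L / 2 * (norm h)\<^sup>2"
proof -
  define \<psi> where "\<psi> t = f (y + t *\<^sub>R h) - t * (gradient f y \<bullet> h) - L / 2 * t\<^sup>2 * (norm h)\<^sup>2" for t
  have "\<psi> 1 \<le> \<psi> 0"
  proof (rule DERIV_nonpos_imp_nonincreasing[where f = \<psi>])
    fix t :: real
    assume t: "0 \<le> t" "t \<le> 1"
    define D where "D = h \<bullet> (gradient f (y + t *\<^sub>R h) - gradient f y)"
    have "GDERIV f (y + t *\<^sub>R h) :> gradient f (y + t *\<^sub>R h)"
      using assms by (auto simp: L_smooth_def intro: GDERIV_gradient)
    from GDERIV_along_line[OF this]
    have "(\<psi> has_real_derivative D - L * t * (norm h)\<^sup>2) (at t)"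
      unfolding \<psi>_def D_def
      by (auto intro!: derivative_eq_intros simp: inner_diff_right inner_commute)
    moreover have "D \<le> L * t * (norm h)\<^sup>2"
    proof -
      have "D \<le> norm h * norm (gradient f (y + t *\<^sub>R h) - gradient f y)"
        unfolding D_def by (rule norm_cauchy_schwarz)
      also have "\<dots> \<le> norm h * (L * norm (y + t *\<^sub>R h - y))"
        using assms unfolding L_smooth_def by (intro mult_left_mono norm_ge_zero) blast
      finally show ?thesis
        using t by (simp add: power2_eq_square mult_ac)
    qed
    ultimately show "\<exists>l. (\<psi> has_real_derivative l) (at t) \<and> l \<le> 0"
      by (intro exI[of _ "D - L * t * (norm h)\<^sup>2"]) auto
  qed simp
  then show ?thesis
    by (simp add: \<psi>_def)
qed

text \<open>The displacement \<open>- (1 / L) *\<^sub>R gradient f y\<close> minimizes the quadratic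
  upper bound over all \<open>h\<close>.\<close>

lemma L_smooth_gradient_step:
  fixes f :: "'a::euclidean_space \<Rightarrow> real"
  assumes "L_smooth L f" and "L > 0"
  shows "f (y - (1 / L) *\<^sub>R gradient f y) \<le> f y - (norm (gradient f y))\<^sup>2 / (2 * L)"
  using L_smooth_upper_bound[OF assms(1), of y "- (1 / L) *\<^sub>R gradient f y"] \<open>L > 0\<close>
  by (simp add: dot_square_norm power_divide power2_eq_square field_simps)

text \<open>One iteration with the implicit velocity eliminated: \<open>y\<close> stands for the
  intermediate point, \<open>z\<close> for the minimizer and \<open>y - s *\<^sub>R v\<close> for
  the old iterate.\<close>

lemma Lyapunov_decrease:
  fixes f :: "'a::euclidean_space \<Rightarrow> real" and v y z :: 'a
  assumes pos: "\<alpha> > 0" "L > 0" "s > 0" and step: "s \<le> 1 / sqrt L"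
    and f: "strongly_convex \<alpha> f" "L_smooth L f"
  defines "c \<equiv> 1 + s * sqrt \<alpha>" and "g \<equiv> gradient f y"
  shows "c * (f (y - (1 / L) *\<^sub>R g) - f z
            + 1 / 2 * (norm (sqrt \<alpha> *\<^sub>R (y - z) + (1 / c) *\<^sub>R (v - s *\<^sub>R g)))\<^sup>2)
         \<le> f (y - s *\<^sub>R v) - f z + 1 / 2 * (norm (sqrt \<alpha> *\<^sub>R (y - z) + v))\<^sup>2"
proof -
  define q t p where "q = sqrt \<alpha>" and "t = s * q" and "p = y - z"
  have q: "q > 0" "q\<^sup>2 = \<alpha>" and t: "t > 0" and c: "c = 1 + t" "c > 0"
    using pos by (auto simp: q_def t_def c_def add_pos_pos)
  have diff: "f differentiable (at y)"
    using f(2) by (simp add: L_smooth_def)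
  note lower = strongly_convex_gradient_lower_bound[OF f(1) diff, folded g_def]
  have descent: "f (y - (1 / L) *\<^sub>R g) \<le> f y - (g \<bullet> g) / (2 * L)"
    using L_smooth_gradient_step[OF f(2) pos(2)] by (simp add: g_def dot_square_norm)
  have to_z: "f y - f z \<le> g \<bullet> p - \<alpha> / 2 * (p \<bullet> p)"
    using lower[of z] by (simp add: p_def dot_square_norm norm_minus_commute inner_diff_right)
  have to_x: "f (y - s *\<^sub>R v) \<ge> f y - s * (g \<bullet> v) + t\<^sup>2 * (v \<bullet> v) / 2"
    using lower[of "y - s *\<^sub>R v"] q
    by (simp add: dot_square_norm power_mult_distrib t_def mult_ac)
  have "s\<^sup>2 \<le> (1 / sqrt L)\<^sup>2"
    using step pos by (intro power_mono) auto
  then have sL: "s\<^sup>2 \<le> 1 / L"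
    using pos by (simp add: power_divide)
  have new: "c * (norm (q *\<^sub>R p + (1 / c) *\<^sub>R (v - s *\<^sub>R g)))\<^sup>2
      = c * \<alpha> * (p \<bullet> p) + 2 * q * (p \<bullet> v) - 2 * t * (g \<bullet> p)
        + (v \<bullet> v - 2 * s * (g \<bullet> v) + s\<^sup>2 * (g \<bullet> g)) / c"
  proof -
    define w where "w = v - s *\<^sub>R g"
    have "(norm (q *\<^sub>R p + (1 / c) *\<^sub>R w))\<^sup>2 = q\<^sup>2 * (p \<bullet> p) + 2 * q * (p \<bullet> w) / c + (w \<bullet> w) / c\<^sup>2"
      unfolding power2_norm_eq_inner
      by (simp add: inner_simps inner_commute power2_eq_square)
    then have "c * (norm (q *\<^sub>R p + (1 / c) *\<^sub>R w))\<^sup>2 = c * \<alpha> * (p \<bullet> p) + 2 * q * (p \<bullet> w) + (w \<bullet> w) / c"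
      using c(2) q(2) by (simp add: distrib_left power2_eq_square)
    moreover have "2 * q * (p \<bullet> w) = 2 * q * (p \<bullet> v) - 2 * t * (g \<bullet> p)"
      by (simp add: w_def t_def inner_simps inner_commute algebra_simps)
    moreover have "w \<bullet> w = v \<bullet> v - 2 * s * (g \<bullet> v) + s\<^sup>2 * (g \<bullet> g)"
      by (simp add: w_def inner_simps inner_commute power2_eq_square algebra_simps)
    ultimately show ?thesis
      by (simp add: w_def)
  qed
  have old: "(norm (q *\<^sub>R p + v))\<^sup>2 = \<alpha> * (p \<bullet> p) + 2 * q * (p \<bullet> v) + v \<bullet> v"
    unfolding q(2)[symmetric] power2_norm_eq_inner
    by (simp add: inner_simps inner_commute power2_eq_square)
  \<comment> \<open>Twice the inequality left over once the terms in \<open>p\<close> cancel and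
    \<open>to_x\<close> has bounded \<open>f y - f (y - s *\<^sub>R v)\<close>.\<close>
  have form: "(v \<bullet> v - 2 * s * (g \<bullet> v) + s\<^sup>2 * (g \<bullet> g)) / c
      \<le> c * (g \<bullet> g) / L - 2 * s * (g \<bullet> v) + t\<^sup>2 * (v \<bullet> v) + v \<bullet> v"
  proof -
    \<comment> \<open>After multiplication by \<open>c\<close> the cross terms differ by
      \<open>2 * t * s * (g \<bullet> v)\<close>. The square splits this excess:
      \<open>c * (v \<bullet> v)\<close> has \<open>t * (v \<bullet> v)\<close> to spare, and the
      coefficient of \<open>g \<bullet> g\<close> grows to \<open>(1 + t) * s\<^sup>2\<close>, which
      the step size bound keeps below \<open>c\<^sup>2 / L\<close>.\<close>
    have "0 \<le> t * ((v - s *\<^sub>R g) \<bullet> (v - s *\<^sub>R g))"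
      using t by simp
    then have square: "2 * t * s * (g \<bullet> v) \<le> t * (v \<bullet> v) + t * s\<^sup>2 * (g \<bullet> g)"
      by (simp add: inner_simps inner_commute power2_eq_square algebra_simps)
    have "(1 + t) * (s\<^sup>2 * (g \<bullet> g)) \<le> c\<^sup>2 * (s\<^sup>2 * (g \<bullet> g))"
      using t by (intro mult_right_mono mult_nonneg_nonneg) (auto simp: c power2_eq_square algebra_simps)
    also have "\<dots> \<le> c\<^sup>2 * (1 / L * (g \<bullet> g))"
      using sL by (intro mult_left_mono mult_right_mono) auto
    finally have "s\<^sup>2 * (g \<bullet> g) + t * s\<^sup>2 * (g \<bullet> g) \<le> c * (c * (g \<bullet> g) / L)"
      by (simp add: power2_eq_square algebra_simps)
    moreover have "0 \<le> c * (t\<^sup>2 * (v \<bullet> v))"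
      using c by simp
    moreover have "c * (v \<bullet> v) = v \<bullet> v + t * (v \<bullet> v)"
      and "c * (2 * s * (g \<bullet> v)) = 2 * s * (g \<bullet> v) + 2 * t * s * (g \<bullet> v)"
      by (simp_all add: c algebra_simps)
    ultimately have "v \<bullet> v - 2 * s * (g \<bullet> v) + s\<^sup>2 * (g \<bullet> g)
        \<le> c * (c * (g \<bullet> g) / L - 2 * s * (g \<bullet> v) + t\<^sup>2 * (v \<bullet> v) + v \<bullet> v)"
      using square unfolding distrib_left right_diff_distrib by linarith
    then show ?thesis
      using c(2) by (simp add: pos_divide_le_eq mult.commute[of _ c])
  qed
  have "c * (f (y - (1 / L) *\<^sub>R g) - f z) \<le> c * (f y - (g \<bullet> g) / (2 * L) - f z)"
    using descent c by simp
  \<comment> \<open>Of the \<open>1 + t\<close> copies of the gap, \<open>t\<close> are bounded by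
    \<open>to_z\<close>, producing the terms in \<open>p\<close> that cancel those of
    \<open>new\<close>; the remaining copy is compared with the old iterate through
    \<open>to_x\<close>.\<close>
  also have "\<dots> = t * (f y - f z) + (f y - f z) - c * (g \<bullet> g) / L / 2"
    by (simp add: c(1) field_simps)
  also have "\<dots> \<le> t * (g \<bullet> p - \<alpha> / 2 * (p \<bullet> p)) + (f y - f z) - c * (g \<bullet> g) / L / 2"
    using to_z t by simp
  finally have "c * (f (y - (1 / L) *\<^sub>R g) - f z)
      \<le> t * (g \<bullet> p) - t * \<alpha> * (p \<bullet> p) / 2 + (f y - f z) - c * (g \<bullet> g) / L / 2"
    by (simp add: algebra_simps)
  moreover have "c * \<alpha> * (p \<bullet> p) = \<alpha> * (p \<bullet> p) + t * \<alpha> * (p \<bullet> p)"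
    by (simp add: c(1) algebra_simps)
  ultimately have "c * (f (y - (1 / L) *\<^sub>R g) - f z)
      + c * (norm (q *\<^sub>R p + (1 / c) *\<^sub>R (v - s *\<^sub>R g)))\<^sup>2 / 2
      \<le> f (y - s *\<^sub>R v) - f z + (norm (q *\<^sub>R p + v))\<^sup>2 / 2"
    using new old form to_x by argo
  then show ?thesis
    by (simp add: q_def p_def distrib_left)
qed

theorem theorem2:
  fixes f :: "real ^ 'd \<Rightarrow> real"
    and xstar :: "real ^ 'd"
    and \<alpha> L s :: real
    and x v x' v' :: "nat \<Rightarrow> real ^ 'd"
    and Lyap :: "nat \<Rightarrow> real"
  assumes "\<alpha> > 0" and "L > 0"
    and "strongly_convex \<alpha> f" and "L_smooth L f"
    and "\<forall>y. f xstar \<le> f y"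
    and "s > 0" and "s \<le> 1 / sqrt L"
    and "\<And>n. x' n = x n + s *\<^sub>R v n"
    and "\<And>n. v' n = v n
           - inverse (1 + s * sqrt \<alpha>) *\<^sub>R ((s * sqrt \<alpha>) *\<^sub>R v n + s *\<^sub>R gradient f (x' n))
           - (s * sqrt \<alpha>) *\<^sub>R v' n"
    and "\<And>n. x (Suc n) = x' n - (1 / L) *\<^sub>R gradient f (x' n)"
    and "\<And>n. v (Suc n) = v' n
           + (inverse (1 + s * sqrt \<alpha>) * (sqrt \<alpha> / L)) *\<^sub>R gradient f (x' n)"
    and "\<And>n. Lyap n = f (x n) - f xstar
           + 1 / 2 * (norm (sqrt \<alpha> *\<^sub>R (x n - xstar) + (1 + s * sqrt \<alpha>) *\<^sub>R v n))\<^sup>2"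
  shows "(\<forall>n. Lyap (Suc n) \<le> inverse (1 + s * sqrt \<alpha>) * Lyap n) \<and>
         (v 0 = 0 \<longrightarrow>
           (\<forall>n. f (x n) - f xstar
              \<le> 2 * (1 + s * sqrt \<alpha>) powi (- int n) * (f (x 0) - f xstar)))"
proof -
  define c where "c = 1 + s * sqrt \<alpha>"
  have c: "c > 0"
    using assms(1,6) by (simp add: c_def add_pos_pos)
  have v': "v' n = (1 / c\<^sup>2) *\<^sub>R (v n - s *\<^sub>R gradient f (x' n))" for n
  proof -
    have "c *\<^sub>R v' n = v' n + (s * sqrt \<alpha>) *\<^sub>R v' n"
      by (simp add: c_def algebra_simps)
    also have "\<dots> = v n - (1 / c) *\<^sub>R ((c - 1) *\<^sub>R v n + s *\<^sub>R gradient f (x' n))"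
      \<comment> \<open>Only the first \<open>v' n\<close> is unfolded, so that the implicit term on
        the right of the recursion cancels the second summand.\<close>
      by (subst (1) assms(9)) (simp add: c_def divide_inverse)
    finally have "c *\<^sub>R (c *\<^sub>R v' n)
        = c *\<^sub>R (v n - (1 / c) *\<^sub>R ((c - 1) *\<^sub>R v n + s *\<^sub>R gradient f (x' n)))"
      by (rule arg_cong)
    also have "\<dots> = c *\<^sub>R v n - ((c - 1) *\<^sub>R v n + s *\<^sub>R gradient f (x' n))"
      using c by (simp only: scaleR_diff_right) simp
    also have "\<dots> = v n - s *\<^sub>R gradient f (x' n)"
      by (simp add: algebra_simps)
    finally have "(1 / c\<^sup>2) *\<^sub>R (c\<^sup>2 *\<^sub>R v' n) = (1 / c\<^sup>2) *\<^sub>R (v n - s *\<^sub>R gradient f (x' n))"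
      by (simp add: power2_eq_square)
    then show ?thesis
      using c by simp
  qed
  have decrease: "Lyap (Suc n) \<le> inverse c * Lyap n" for n
  proof -
    define g where "g = gradient f (x' n)"
    have x: "x n = x' n - s *\<^sub>R v n"
      by (simp add: assms(8))
    \<comment> \<open>The excess of the weight \<open>c\<close> over 1 is exactly what moves
      \<open>x n\<close> to \<open>x' n\<close>.\<close>
    have old: "sqrt \<alpha> *\<^sub>R (x n - xstar) + c *\<^sub>R v n = sqrt \<alpha> *\<^sub>R (x' n - xstar) + v n"
      by (simp add: x c_def algebra_simps)
    \<comment> \<open>The gradient correction in the velocity update is chosen to cancel the shift
      of the position by the gradient step.\<close>
    have "c *\<^sub>R v (Suc n) = (1 / c) *\<^sub>R (v n - s *\<^sub>R g) + (sqrt \<alpha> / L) *\<^sub>R g"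
      using c by (simp add: assms(11)[folded c_def] v' g_def scaleR_add_right power2_eq_square)
    then have new: "sqrt \<alpha> *\<^sub>R (x (Suc n) - xstar) + c *\<^sub>R v (Suc n)
        = sqrt \<alpha> *\<^sub>R (x' n - xstar) + (1 / c) *\<^sub>R (v n - s *\<^sub>R g)"
      by (simp add: assms(10) g_def scaleR_diff_right)
    have "c * Lyap (Suc n) \<le> Lyap n"
      using Lyapunov_decrease[OF assms(1,2,6,7,3,4), of "x' n" xstar "v n"]
      unfolding assms(12) c_def[symmetric] old new
      by (simp add: assms(10) x g_def)
    then show ?thesis
      using c by (simp add: field_simps)
  qed
  have bound: "f (x n) - f xstar \<le> 2 * c powi (- int n) * (f (x 0) - f xstar)"
    if "v 0 = 0" for n
  proof -
    have "Lyap n \<le> inverse c ^ n * Lyap 0"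
    proof (induction n)
      case (Suc n)
      have "inverse c * Lyap n \<le> inverse c * (inverse c ^ n * Lyap 0)"
        using Suc c by (intro mult_left_mono) auto
      then show ?case
        using decrease[of n] by (simp add: mult.assoc)
    qed simp
    \<comment> \<open>Source of the factor 2: for zero initial velocity the quadratic term is
      \<open>\<alpha> / 2 * (norm (x 0 - xstar))\<^sup>2\<close>, itself at most the initial
      gap.\<close>
    also have "Lyap 0 \<le> 2 * (f (x 0) - f xstar)"
      using strongly_convex_minimizer_lower_bound[OF assms(3,5), of "x 0"] assms(1) that
      by (simp add: assms(12) power_mult_distrib)
    finally have "Lyap n \<le> inverse c ^ n * (2 * (f (x 0) - f xstar))"
      using c by (simp add: mult_left_mono)
    moreover have "f (x n) - f xstar \<le> Lyap n"
      by (simp add: assms(12))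
    ultimately show ?thesis
      by (simp add: power_int_minus power_inverse algebra_simps)
  qed
  show ?thesis
    using decrease bound unfolding c_def by blast
qed

end
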